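(* Let $T>0$, $H\in(1/2,1)$, $\kappa,\theta\in\mathbb{R}$ with $\kappa\theta>0$, $\sigma>0$, $X_0>0$, and let $\{B(t)\}_{t\in[0,T]}$ be a fractional Brownian motion with Hurst parameter $H$. Let $\xi\in(0,1)$ and $p\ge 2$, and assume that $$\kappa\theta \exp\left(\frac{\kappa s}{2}\right) \ge (3p+1)\int_{0}^{s} \frac{\sigma^2}{2} \exp\left(\frac{\kappa \tau}{2}\right) \phi(\tau,s)\,d\tau, \qquad \forall\, 0\le s\le T,$$ where $\phi(\tau,s)=H(2H-1)|s-\tau|^{2H-2}$. Let $h=T/N$, $N\in\{1,2,\dots\}$, with $h\in(0,1)$ and $h\max\{0,-\kappa/2\}<1-\xi$. With $t_n=nh$ and $\Delta B_{n+1}=B(t_{n+1})-B(t_n)$, define, starting from $X_0$, for $n=0,\dots,N-1$, $$X_{n+1}=\frac{X_n+\frac12\sigma\Delta B_{n+1}+\sqrt{\left(X_n+\frac12\sigma \Delta B_{n+1}\right)^2+\kappa h\theta (2+\kappa h)}}{2+\kappa h},$$ $$X^h(t)=X_n+\frac{t-t_n}{h}(X_{n+1}-X_n)\ \text{ for } t\in(t_n,t_{n+1}],\qquad X^h(0)=X_0.$$ Let $f(x)=\frac12\kappa\left(\frac{\theta}{x}-x\right)$ for $x>0$. If $\kappa>0$, then for any $t\in(t_n,t_{n+1}]$, $n=0,\dots,N-1$, the Malliavin derivative of $X^h(t)$ is $$D_s[X^h(t)]=\frac{t_{n+1}-t}{h}G_n(s)\mathbf 1_{[0,t_n]}(s)+\frac{t-t_n}{h}G_{n+1}(s)\mathbf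 1_{[0,t_{n+1}]}(s),$$ where $G_n(s)=\frac12\sigma \prod_{j=i}^{n}(1-f'(X_{j})h)^{-1}$ for $s\in(t_{i-1},t_{i}]$, $i=1,\dots,n$.
   Context: A fractional Brownian motion with Hurst parameter $H$ on a probability space $(\Omega,\mathcal{F},\mathbb{P})$ is a centered Gaussian process with continuous sample paths and covariance $\mathrm{Cov}(t,s)=\mathbb{E}[B(t)B(s)]=\frac12(t^{2H}+s^{2H}-|t-s|^{2H})$. $\mathcal{H}$ is the Hilbert space obtained as the closure of the step functions on $[0,T]$ with respect to the inner product determined by $\langle \mathbf 1_{[0,t]},\mathbf 1_{[0,s]}\rangle_{\mathcal H}=\mathrm{Cov}(t,s)$. For $F=f_0(B(s_1),\dots,B(s_M))$ with $s_1,\dots,s_M\in[0,T]$ and $f_0$ a bounded smooth function on $\mathbb{R}^M$ with all derivatives bounded, the Malliavin derivative is the $\mathcal H$-valued random variable $D_\cdot F=\sum_{i=1}^M \frac{\partial f_0}{\partial x_i}(B(s_1),\dots,B(s_M))\mathbf 1_{[0,s_i]}(\cdot)$. The space $\mathbb{D}^{1,q}$, $q\ge1$, is the closure of the set of such $F$ in the norm $\|F\|_{\mathbb{D}^{1,q}}=(\mathbb{E}[|F|^q]+\mathbb{E}[\|DF\|_{\mathcal H}^q])^{1/q}$, and $D$ is extended to it (here $q=2$) by closure. The displayed identity for $D_s[X^h(t)]$ is an almost sure identity of $\mathcal H$-valued random variables, with the right-hand side viewed as a function of $s\in[0,T]$ (its value at the single point $s=0$ is irrelevant). For $n=0$ the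 term containing $G_0(s)\mathbf 1_{[0,t_0]}(s)$ is zero, since $X_0$ is deterministic. Here $f'(x)=-\frac{\kappa\theta}{2x^2}-\frac{\kappa}{2}$, and all $X_n$ are strictly positive. *)

theory Defs
  imports "HOL-Probability.Probability"
begin

section \<open>Fractional Brownian motion\<close>

definition fbm_cov :: "real \<Rightarrow> real \<Rightarrow> real \<Rightarrow> real" where
  "fbm_cov H t s = (t powr (2 * H) + s powr (2 * H) - \<bar>t - s\<bar> powr (2 * H)) / 2"

text \<open>Point masses count as (degenerate) Gaussian distributions; already \<open>B 0\<close> is one.\<close>

definition gaussian_rv :: "'a measure \<Rightarrow> ('a \<Rightarrow> real) \<Rightarrow> bool" where
  "gaussian_rv M X \<longleftrightarrow> X \<in> borel_measurable M \<and>
     ((\<exists>\<mu>. AE \<omega> in M. X \<omega> = \<mu>) \<or>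
      (\<exists>\<mu> \<sigma>. \<sigma> > 0 \<and> distributed M lborel X (normal_density \<mu> \<sigma>)))"

definition gaussian_process :: "'a measure \<Rightarrow> real set \<Rightarrow> (real \<Rightarrow> 'a \<Rightarrow> real) \<Rightarrow> bool" where
  "gaussian_process M I B \<longleftrightarrow>
     (\<forall>(m::nat) t c. (\<forall>i<m. t i \<in> I) \<longrightarrow> gaussian_rv M (\<lambda>\<omega>. \<Sum>i<m. c i * B (t i) \<omega>))"

locale fractional_brownian_motion = prob_space M for M :: "'a measure" +
  fixes T H :: real and B :: "real \<Rightarrow> 'a \<Rightarrow> real"
  assumes gaussian: "gaussian_process M {0..T} B"
    and centered: "t \<in> {0..T} \<Longrightarrow> expectation (B t) = 0"
    and covariance: "t \<in> {0..T} \<Longrightarrow> s \<in> {0..T} \<Longrightarrow>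
           expectation (\<lambda>\<omega>. B t \<omega> * B s \<omega>) = fbm_cov H t s"
    and continuous_paths: "\<omega> \<in> space M \<Longrightarrow> continuous_on {0..T} (\<lambda>t. B t \<omega>)"


section \<open>The Hilbert space of the covariance\<close>

definition step_functions :: "real \<Rightarrow> (real \<Rightarrow> real) set" where
  "step_functions T =
     {\<phi>. \<exists>(m::nat) c t. (\<forall>i<m. t i \<in> {0..T}) \<and> \<phi> = (\<lambda>r. \<Sum>i<m. c i * indicator {0..t i} r)}"

text \<open>
  The Hilbert space is the completion of the step functions, which determines it up to a unique
  isometry.  It is given by a complete inner product space \<open>'h\<close> and the canonical
  map \<open>\<iota>\<close> from step functions into it; \<open>\<iota> \<phi>\<close> is the step function \<open>\<phi>\<close> regarded as an
  element of the Hilbert space.  Values of \<open>\<iota>\<close> outside the step functions are unspecified.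
  As \<open>fbm_cov H 0 0 = 0\<close>, \<open>\<iota>\<close> identifies functions that differ only at \<open>0\<close>.
  Second countability (part of \<open>polish_space\<close>) is no restriction: the completion is separable,
  because \<open>t \<mapsto> \<iota> (indicator {0..t})\<close> is continuous.
\<close>

locale fbm_hilbert_space =
  fixes T H :: real and \<iota> :: "(real \<Rightarrow> real) \<Rightarrow> 'h::{real_inner, polish_space}"
  assumes linear: "\<phi> \<in> step_functions T \<Longrightarrow> \<psi> \<in> step_functions T \<Longrightarrow>
           \<iota> (\<lambda>r. a * \<phi> r + b * \<psi> r) = a *\<^sub>R \<iota> \<phi> + b *\<^sub>R \<iota> \<psi>"
    and inner_indicator: "t \<in> {0..T} \<Longrightarrow> s \<in> {0..T} \<Longrightarrow>
           \<iota> (indicator {0..t}) \<bullet> \<iota> (indicator {0..s}) = fbm_cov H t s"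
    and dense: "closure (\<iota> ` step_functions T) = UNIV"


section \<open>The Malliavin derivative\<close>

text \<open>
  A function on $\mathbb{R}^m$ is represented by a function on sequences that depends on the
  coordinates \<open>0, \<dots>, m - 1\<close> only.
\<close>

definition partial_deriv :: "nat \<Rightarrow> ((nat \<Rightarrow> real) \<Rightarrow> real) \<Rightarrow> (nat \<Rightarrow> real) \<Rightarrow> real" where
  "partial_deriv i f x = deriv (\<lambda>y. f (x(i := y))) (x i)"

definition bounded_smooth :: "nat \<Rightarrow> ((nat \<Rightarrow> real) \<Rightarrow> real) \<Rightarrow> bool" where
  "bounded_smooth m f \<longleftrightarrow>
     (\<forall>x y. (\<forall>i<m. x i = y i) \<longrightarrow> f x = f y) \<and>
     (\<forall>is. set is \<subseteq> {..<m} \<longrightarrow>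
        (let g = foldr partial_deriv is f in
           continuous_on UNIV g \<and> bounded (range g) \<and>
           (\<forall>i<m. \<forall>x. (\<lambda>y. g (x(i := y))) differentiable (at (x i)))))"

definition smooth_malliavin ::
    "real \<Rightarrow> ((real \<Rightarrow> real) \<Rightarrow> 'h::{real_inner, polish_space}) \<Rightarrow> (real \<Rightarrow> 'a \<Rightarrow> real) \<Rightarrow>
     (('a \<Rightarrow> real) \<times> ('a \<Rightarrow> 'h)) set" where
  "smooth_malliavin T \<iota> B =
     {(F, DF). \<exists>m f s. bounded_smooth m f \<and> (\<forall>i<m. s i \<in> {0..T}) \<and>
        F = (\<lambda>\<omega>. f (\<lambda>j. B (s j) \<omega>)) \<and>
        DF = (\<lambda>\<omega>. \<iota> (\<lambda>r. \<Sum>i<m. partial_deriv i f (\<lambda>j. B (s j) \<omega>) * indicator {0..s i} r))}"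

text \<open>The \<open>q\<close>-th power of the graph norm of \<open>D\<close>, for a pair \<open>(F, DF)\<close>.\<close>

definition malliavin_norm_pow ::
    "'a measure \<Rightarrow> real \<Rightarrow> ('a \<Rightarrow> real) \<Rightarrow> ('a \<Rightarrow> 'h::{real_inner, polish_space}) \<Rightarrow> ennreal" where
  "malliavin_norm_pow M q F \<eta> =
     (\<integral>\<^sup>+\<omega>. ennreal (\<bar>F \<omega>\<bar> powr q) \<partial>M) + (\<integral>\<^sup>+\<omega>. ennreal (norm (\<eta> \<omega>) powr q) \<partial>M)"

text \<open>
  The graph of the closed operator \<open>D\<close>: \<open>F\<close> belongs to $\mathbb{D}^{1,q}$ and \<open>D F = \<eta>\<close> almost
  surely.  The space $\mathbb{D}^{1,q}$ is the domain of this relation.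
\<close>

definition has_malliavin_derivative ::
    "'a measure \<Rightarrow> real \<Rightarrow> ((real \<Rightarrow> real) \<Rightarrow> 'h::{real_inner, polish_space}) \<Rightarrow>
     (real \<Rightarrow> 'a \<Rightarrow> real) \<Rightarrow> real \<Rightarrow> ('a \<Rightarrow> real) \<Rightarrow> ('a \<Rightarrow> 'h) \<Rightarrow> bool" where
  "has_malliavin_derivative M T \<iota> B q F \<eta> \<longleftrightarrow>
     F \<in> borel_measurable M \<and> \<eta> \<in> borel_measurable M \<and>
     (\<exists>Fk DFk. (\<forall>k. (Fk k, DFk k) \<in> smooth_malliavin T \<iota> B) \<and>
        (\<lambda>k::nat. malliavin_norm_pow M q (\<lambda>\<omega>. Fk k \<omega> - F \<omega>) (\<lambda>\<omega>. DFk k \<omega> - \<eta> \<omega>))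
          \<longlonglongrightarrow> 0)"


section \<open>The numerical scheme\<close>

definition drift :: "real \<Rightarrow> real \<Rightarrow> real \<Rightarrow> real" where
  "drift \<kappa> \<theta> x = \<kappa> / 2 * (\<theta> / x - x)"

primrec scheme ::
    "real \<Rightarrow> real \<Rightarrow> real \<Rightarrow> real \<Rightarrow> real \<Rightarrow> (real \<Rightarrow> 'a \<Rightarrow> real) \<Rightarrow> nat \<Rightarrow> 'a \<Rightarrow> real" where
  "scheme \<kappa> \<theta> \<sigma> X0 h B 0 \<omega> = X0"
| "scheme \<kappa> \<theta> \<sigma> X0 h B (Suc n) \<omega> =
     (let y = scheme \<kappa> \<theta> \<sigma> X0 h B n \<omega> + \<sigma> / 2 * (B (real (Suc n) * h) \<omega> - B (real n * h) \<omega>)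
      in (y + sqrt (y\<^sup>2 + \<kappa> * h * \<theta> * (2 + \<kappa> * h))) / (2 + \<kappa> * h))"

text \<open>Here \<open>n\<close> is the index with \<open>t \<in> {n * h<..(n + 1) * h}\<close>.\<close>

definition interpolation :: "real \<Rightarrow> (nat \<Rightarrow> 'a \<Rightarrow> real) \<Rightarrow> real \<Rightarrow> 'a \<Rightarrow> real" where
  "interpolation h X t \<omega> =
     (if t = 0 then X 0 \<omega>
      else let n = nat (\<lceil>t / h\<rceil> - 1)
           in X n \<omega> + (t - real n * h) / h * (X (Suc n) \<omega> - X n \<omega>))"

lemma interpolation_eq:
  assumes "h > 0" "t \<in> {real n * h<..real (Suc n) * h}"
  shows "interpolation h X t \<omega> = X n \<omega> + (t - real n * h) / h * (X (Suc n) \<omega> - X n \<omega>)"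
proof -
  have "\<lceil>t / h\<rceil> = int n + 1"
    using assms by (intro ceiling_unique) (auto simp: field_simps)
  moreover have "0 \<le> real n * h"
    using assms by simp
  with assms have "t \<noteq> 0"
    by (metis greaterThanAtMost_iff not_less)
  ultimately show ?thesis
    by (simp add: interpolation_def)
qed

text \<open>At \<open>s = 0\<close>, and for \<open>n = 0\<close>, the sum below has the value \<open>0\<close>.\<close>

definition G_fun ::
    "real \<Rightarrow> real \<Rightarrow> real \<Rightarrow> real \<Rightarrow> (nat \<Rightarrow> 'a \<Rightarrow> real) \<Rightarrow> nat \<Rightarrow> 'a \<Rightarrow> real \<Rightarrow> real" where
  "G_fun \<kappa> \<theta> \<sigma> h X n \<omega> s =
     (\<Sum>i=1..n. \<sigma> / 2 * (\<Prod>j=i..n. inverse (1 - deriv (drift \<kappa> \<theta>) (X j \<omega>) * h))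
        * indicator {real (i - 1) * h<..real i * h} s)"

lemma G_fun_eq:
  assumes "h > 0" "i \<in> {1..n}" "s \<in> {real (i - 1) * h<..real i * h}"
  shows "G_fun \<kappa> \<theta> \<sigma> h X n \<omega> s =
    \<sigma> / 2 * (\<Prod>j=i..n. inverse (1 - deriv (drift \<kappa> \<theta>) (X j \<omega>) * h))"
proof -
  have "s \<notin> {real (k - 1) * h<..real k * h}" if "k \<in> {1..n}" "k \<noteq> i" for k
  proof
    assume k: "s \<in> {real (k - 1) * h<..real k * h}"
    have "real (i - 1) * h < real k * h" "real (k - 1) * h < real i * h"
      using k assms(3) unfolding greaterThanAtMost_iff by linarith+
    hence "i - 1 < k" "k - 1 < i"
      using \<open>h > 0\<close> by (simp_all only: mult_less_cancel_right_pos of_nat_less_iff)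
    with that assms show False
      by auto
  qed
  hence "G_fun \<kappa> \<theta> \<sigma> h X n \<omega> s = (\<Sum>k\<in>{i}. \<sigma> / 2 *
      (\<Prod>j=k..n. inverse (1 - deriv (drift \<kappa> \<theta>) (X j \<omega>) * h))
        * indicator {real (k - 1) * h<..real k * h} s)"
    unfolding G_fun_def using assms by (intro sum.mono_neutral_right) auto
  thus ?thesis
    using assms by simp
qed

end

(* X_n is a smooth function of B(0), B(h), ..., B(nh), obtained by iterating
   step y = (y + sqrt (y^2 + c)) / d with c > 0.  It is unbounded, but its partial derivatives lie in
   the algebra generated by the bounded functions y_k / R_k and 1 / R_k, where y_k is the argument of
   the k-th step and R_k = sqrt (y_k^2 + c); this algebra is closed under partial derivatives.
   Truncating as K sin (X_n / K) therefore gives bounded smooth functionals, which converge in the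
   graph norm of D.  The product formula for G_n comes from step' y = 1 / (1 - h f'(step y)),
   by differentiating x - h f(x) = y. *)
theory Submission
  imports Defs
begin

section \<open>Partial derivatives and bounded smooth functions\<close>

text \<open>\<open>deriv\<close> has a value even where no derivative exists. The relational form
  carries differentiability at every point along with the derivative, so both pass through sums,
  products and compositions.\<close>

definition has_partial ::
    "nat \<Rightarrow> ((nat \<Rightarrow> real) \<Rightarrow> real) \<Rightarrow> ((nat \<Rightarrow> real) \<Rightarrow> real) \<Rightarrow> bool" where
  "has_partial i f f' \<longleftrightarrow>
     (\<forall>x. ((\<lambda>y. f (x(i := y))) has_real_derivative f' x) (at (x i)))"

lemma has_partial_imp_partial_deriv: "has_partial i f f' \<Longrightarrow> partial_deriv i f = f'"
  unfolding has_partial_def partial_deriv_def by (simp add: fun_eq_iff DERIV_imp_deriv)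

lemma has_partial_const: "has_partial i (\<lambda>x. c) (\<lambda>x. 0)"
  by (simp add: has_partial_def)

lemma has_partial_coordinate_diff:
  "has_partial i (\<lambda>x. x k - x j) (\<lambda>x. of_bool (i = k) - of_bool (i = j))"
  by (auto simp: has_partial_def intro!: derivative_eq_intros)

lemma has_partial_add:
  "has_partial i f f' \<Longrightarrow> has_partial i g g' \<Longrightarrow> has_partial i (\<lambda>x. f x + g x) (\<lambda>x. f' x + g' x)"
  unfolding has_partial_def by (auto intro!: derivative_intros)

lemma has_partial_mult:
  assumes "has_partial i f f'" "has_partial i g g'"
  shows "has_partial i (\<lambda>x. f x * g x) (\<lambda>x. f' x * g x + f x * g' x)"
  unfolding has_partial_def
proof
  fix x :: "nat \<Rightarrow> real"
  show "((\<lambda>y. f (x(i := y)) * g (x(i := y))) has_real_derivative f' x * g x + f x * g' x) (at (x i))"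
    using DERIV_mult[of "\<lambda>y. f (x(i := y))" "f' x" "x i" UNIV "\<lambda>y. g (x(i := y))" "g' x"] assms
    by (simp add: has_partial_def algebra_simps)
qed

lemma has_partial_cmult:
  "has_partial i f f' \<Longrightarrow> has_partial i (\<lambda>x. c * f x) (\<lambda>x. c * f' x)"
  using has_partial_mult[OF has_partial_const] by simp

lemma has_partial_compose:
  assumes "\<And>y. (\<phi> has_real_derivative \<phi>' y) (at y)" "has_partial i f f'"
  shows "has_partial i (\<lambda>x. \<phi> (f x)) (\<lambda>x. \<phi>' (f x) * f' x)"
  unfolding has_partial_def
proof
  fix x :: "nat \<Rightarrow> real"
  show "((\<lambda>y. \<phi> (f (x(i := y)))) has_real_derivative \<phi>' (f x) * f' x) (at (x i))"
    using DERIV_chain2[of \<phi> "\<phi>' (f x)" "\<lambda>y. f (x(i := y))" "x i" "f' x" UNIV] assms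
    by (simp add: has_partial_def)
qed

section \<open>Function algebras closed under partial derivatives\<close>

inductive_set fun_algebra :: "('a \<Rightarrow> real) set \<Rightarrow> ('a \<Rightarrow> real) set"
  for \<G> :: "('a \<Rightarrow> real) set" where
  const: "(\<lambda>x. c) \<in> fun_algebra \<G>"
| gen: "g \<in> \<G> \<Longrightarrow> g \<in> fun_algebra \<G>"
| add: "f \<in> fun_algebra \<G> \<Longrightarrow> g \<in> fun_algebra \<G> \<Longrightarrow> (\<lambda>x. f x + g x) \<in> fun_algebra \<G>"
| mult: "f \<in> fun_algebra \<G> \<Longrightarrow> g \<in> fun_algebra \<G> \<Longrightarrow> (\<lambda>x. f x * g x) \<in> fun_algebra \<G>"

lemma has_partial_bexI: "has_partial i f f' \<Longrightarrow> f' \<in> A \<Longrightarrow> \<exists>f'\<in>A. has_partial i f f'"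
  by blast

lemma fun_algebra_mono: "\<G> \<subseteq> \<G>' \<Longrightarrow> f \<in> fun_algebra \<G> \<Longrightarrow> f \<in> fun_algebra \<G>'"
  by (rotate_tac, induction rule: fun_algebra.induct) (auto intro: fun_algebra.intros)

lemma fun_algebra_continuous:
  assumes "\<And>g. g \<in> \<G> \<Longrightarrow> continuous_on UNIV g" "f \<in> fun_algebra \<G>"
  shows "continuous_on UNIV f"
  using assms(2) by induction (simp_all add: assms(1) continuous_on_add continuous_on_mult)

lemma fun_algebra_bounded:
  assumes "\<And>g. g \<in> \<G> \<Longrightarrow> bounded (range g)" "f \<in> fun_algebra \<G>"
  shows "bounded (range f)"
  using assms(2)
proof induction
  case (const c)
  show ?case by (simp add: image_def)
next
  case (gen g)
  thus ?case by (rule assms(1))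
next
  case (add f g)
  then obtain a b where "\<bar>f x\<bar> \<le> a" "\<bar>g x\<bar> \<le> b" for x
    by (auto simp: bounded_iff)
  hence "\<bar>f x + g x\<bar> \<le> a + b" for x
    by (intro order.trans[OF abs_triangle_ineq] add_mono)
  thus ?case by (auto simp: bounded_iff)
next
  case (mult f g)
  then obtain a b where *: "\<bar>f x\<bar> \<le> a" "\<bar>g x\<bar> \<le> b" for x
    by (auto simp: bounded_iff)
  have "\<bar>f x * g x\<bar> \<le> a * b" for x
    unfolding abs_mult using *[of x] by (intro mult_mono) auto
  thus ?case by (auto simp: bounded_iff)
qed

text \<open>The sum and product rules express a derivative through members and their derivatives, so
  closure needs checking on the generators only.\<close>

lemma fun_algebra_has_partial:
  assumes "\<And>g. g \<in> \<G> \<Longrightarrow> \<exists>g'\<in>fun_algebra \<G>. has_partial i g g'" "f \<in> fun_algebra \<G>"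
  shows "\<exists>f'\<in>fun_algebra \<G>. has_partial i f f'"
  using assms(2)
proof induction
  case (const c)
  show ?case using has_partial_const fun_algebra.const by blast
next
  case (gen g)
  thus ?case by (rule assms(1))
next
  case (add f g)
  then obtain f' g' where "f' \<in> fun_algebra \<G>" "has_partial i f f'"
    "g' \<in> fun_algebra \<G>" "has_partial i g g'" by (elim bexE) (rule that)
  thus ?case
    by (intro has_partial_bexI[OF has_partial_add] fun_algebra.add)
next
  case (mult f g)
  then obtain f' g' where "f' \<in> fun_algebra \<G>" "has_partial i f f'"
    "g' \<in> fun_algebra \<G>" "has_partial i g g'" by (elim bexE) (rule that)
  with mult.hyps show ?case
    by (intro has_partial_bexI[OF has_partial_mult] fun_algebra.add fun_algebra.mult)
qed

text \<open>All iterated partial derivatives of \<open>f\<close> stay in the algebra, whose members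
  are continuous, bounded and partially differentiable. This settles every order of differentiation
  at once.\<close>

lemma bounded_smooth_fun_algebra:
  assumes cont: "\<And>g. g \<in> \<G> \<Longrightarrow> continuous_on UNIV g"
    and bdd: "\<And>g. g \<in> \<G> \<Longrightarrow> bounded (range g)"
    and partial: "\<And>g i. g \<in> \<G> \<Longrightarrow> \<exists>g'\<in>fun_algebra \<G>. has_partial i g g'"
    and f: "f \<in> fun_algebra \<G>"
    and local: "\<And>x y. (\<And>i. i < m \<Longrightarrow> x i = y i) \<Longrightarrow> f x = f y"
  shows "bounded_smooth m f"
proof -
  have alg: "foldr partial_deriv is f \<in> fun_algebra \<G>" for "is"
  proof (induction "is")
    case (Cons i "is")
    from fun_algebra_has_partial[OF partial Cons, where i=i] show ?case
      by (auto dest!: has_partial_imp_partial_deriv)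
  qed (use f in simp)
  have "(\<lambda>y. foldr partial_deriv is f (x(i := y))) differentiable (at (x i))" for "is" x i
    using fun_algebra_has_partial[OF partial alg, of i "is"] 
    by (auto simp: has_partial_def real_differentiable_def)
  thus ?thesis
    unfolding bounded_smooth_def Let_def
    using fun_algebra_continuous[OF cont alg] fun_algebra_bounded[OF bdd alg]
    by (intro conjI allI impI) (rule local, simp_all)
qed

section \<open>The scheme as a function of the driving path\<close>

locale implicit_scheme =
  fixes \<kappa> \<theta> \<sigma> X0 h :: real
  assumes kappa_pos: "\<kappa> > 0" and theta_pos: "\<theta> > 0" and h_pos: "h > 0"
begin

definition root_term :: "real \<Rightarrow> real" where
  "root_term y = sqrt (y\<^sup>2 + \<kappa> * h * \<theta> * (2 + \<kappa> * h))"

definition step :: "real \<Rightarrow> real" where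
  "step y = (y + root_term y) / (2 + \<kappa> * h)"

text \<open>The scheme with the sampled values \<open>B (real k * h) \<omega>\<close> replaced by
  free coordinates \<open>x k\<close>, so that partial derivatives make sense.\<close>

primrec state :: "nat \<Rightarrow> (nat \<Rightarrow> real) \<Rightarrow> real" where
  "state 0 x = X0"
| "state (Suc n) x = step (state n x + \<sigma> / 2 * (x (Suc n) - x n))"

definition explicit_part :: "nat \<Rightarrow> (nat \<Rightarrow> real) \<Rightarrow> real" where
  "explicit_part n x = state n x + \<sigma> / 2 * (x (Suc n) - x n)"

text \<open>The derivative of \<open>step\<close>, written through the bounded quotient
  \<open>y / root_term y\<close> so that membership in the algebra of \<open>generators\<close> can
  be read off.\<close>

definition slope :: "real \<Rightarrow> real" where
  "slope y = (1 + y / root_term y) / (2 + \<kappa> * h)"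

text \<open>The chain rule for \<open>state\<close> in coordinate \<open>i\<close>. The two
  \<open>of_bool\<close> terms come from differentiating the increment
  \<open>x (Suc n) - x n\<close>.\<close>

primrec dstate :: "nat \<Rightarrow> nat \<Rightarrow> (nat \<Rightarrow> real) \<Rightarrow> real" where
  "dstate i 0 x = 0"
| "dstate i (Suc n) x = slope (explicit_part n x) *
     (dstate i n x + \<sigma> / 2 * (of_bool (i = Suc n) - of_bool (i = n)))"

definition generators :: "((nat \<Rightarrow> real) \<Rightarrow> real) set" where
  "generators = range (\<lambda>n x. explicit_part n x / root_term (explicit_part n x))
     \<union> range (\<lambda>n x. inverse (root_term (explicit_part n x)))"

section \<open>Bounds and derivatives for one update of the scheme\<close>

lemma disc_pos: "\<kappa> * h * \<theta> * (2 + \<kappa> * h) > 0"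
  using kappa_pos theta_pos h_pos by (simp add: add_pos_pos)

lemma denom_pos: "2 + \<kappa> * h > 0"
  using kappa_pos h_pos by (simp add: add_pos_pos)

lemma root_term_sq: "(root_term y)\<^sup>2 = y\<^sup>2 + \<kappa> * h * \<theta> * (2 + \<kappa> * h)"
  using disc_pos by (simp add: root_term_def)

lemma abs_less_root_term: "\<bar>y\<bar> < root_term y"
  using disc_pos by (simp add: root_term_def real_less_rsqrt)

lemma root_term_pos: "root_term y > 0"
  using abs_less_root_term[of y] by linarith

lemma step_pos: "step y > 0"
  using abs_less_root_term[of y] denom_pos by (simp add: step_def)

text \<open>The numerator of \<open>step y\<close> is at most \<open>2 * root_term y\<close> and its
  denominator at least 2. The bound later carries square integrability through one update.\<close>

lemma step_sq_le: "(step y)\<^sup>2 \<le> y\<^sup>2 + \<kappa> * h * \<theta> * (2 + \<kappa> * h)"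
proof -
  have "step y \<le> 2 * root_term y / 2"
    unfolding step_def using abs_less_root_term[of y] kappa_pos h_pos
    by (intro frac_le) auto
  thus ?thesis
    using step_pos[of y] power_mono[of "step y" "root_term y" 2] by (simp add: root_term_sq)
qed

lemma DERIV_root_term: "(root_term has_real_derivative y / root_term y) (at y)"
proof -
  have "y\<^sup>2 + \<kappa> * h * \<theta> * (2 + \<kappa> * h) > 0"
    using disc_pos by (simp add: add_nonneg_pos)
  thus ?thesis
    unfolding root_term_def by (auto intro!: derivative_eq_intros simp: field_simps)
qed

lemma DERIV_step: "(step has_real_derivative slope y) (at y)"
  unfolding step_def slope_def using denom_pos
  by (auto intro!: derivative_eq_intros DERIV_root_term)

text \<open>Here and in \<open>DERIV_normalised\<close> the derivative is spelled as a polynomial in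
  the two generators, with \<open>- 1\<close> as a constant factor, to match the rules of
  \<open>fun_algebra\<close>.\<close>

lemma DERIV_inverse_root_term:
  "((\<lambda>y. inverse (root_term y)) has_real_derivative
     (- 1) * (y / root_term y) * (inverse (root_term y) * inverse (root_term y))) (at y)"
  using root_term_pos[of y]
  by (auto intro!: derivative_eq_intros DERIV_root_term simp: field_simps)

lemma DERIV_normalised:
  "((\<lambda>y. y / root_term y) has_real_derivative
     inverse (root_term y) * (1 + (- 1) * (y / root_term y) * (y / root_term y))) (at y)"
  using root_term_pos[of y]
  by (auto intro!: derivative_eq_intros DERIV_root_term simp: field_simps)

text \<open>\<open>step y\<close> is the positive root \<open>x\<close> of the implicit equation \<open>x - h * drift x = y\<close>.\<close>

lemma slope_eq: "slope y = inverse (1 - deriv (drift \<kappa> \<theta>) (step y) * h)"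
proof -
  define x R d where "x = step y" and "R = root_term y" and "d = 2 + \<kappa> * h"
  have pos: "x > 0" "R > 0" "d > 0"
    using step_pos root_term_pos denom_pos by (auto simp: x_def R_def d_def)
  have dx: "y = d * x - R"
    using pos by (simp add: x_def R_def d_def step_def)
  have R2: "R\<^sup>2 = y\<^sup>2 + \<kappa> * h * \<theta> * d"
    by (simp add: R_def d_def root_term_sq)
  \<comment> \<open>Substituting \<open>y = d * x - R\<close> into \<open>R2\<close> cancels the
    square of \<open>R\<close> and leaves a common factor \<open>d\<close>.\<close>
  have "d * (d * x\<^sup>2 - 2 * x * R + \<kappa> * h * \<theta>) = 0"
    using R2 unfolding dx by (simp add: power2_eq_square algebra_simps)
  hence key: "d * x\<^sup>2 + \<kappa> * h * \<theta> = 2 * x * R"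
    using pos by simp
  have "deriv (drift \<kappa> \<theta>) x = \<kappa> / 2 * (- \<theta> / x\<^sup>2 - 1)"
    unfolding drift_def using pos
    by (intro DERIV_imp_deriv) (auto intro!: derivative_eq_intros simp: power2_eq_square)
  hence "1 - deriv (drift \<kappa> \<theta>) x * h = 1 - \<kappa> / 2 * (- \<theta> / x\<^sup>2 - 1) * h"
    by simp
  also have "\<dots> = (d * x\<^sup>2 + \<kappa> * h * \<theta>) / (2 * x\<^sup>2)"
    using pos by (simp add: d_def field_simps)
  also have "\<dots> = R / x"
    unfolding key using pos by (simp add: power2_eq_square)
  finally have "inverse (1 - deriv (drift \<kappa> \<theta>) x * h) = x / R"
    by simp
  \<comment> \<open>By \<open>dx\<close>, \<open>R + y = d * x\<close>, and the factor
    \<open>d\<close> cancels.\<close>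
  moreover have "slope y = x / R"
    unfolding slope_def R_def[symmetric] d_def[symmetric] using pos
    by (simp add: dx field_simps)
  ultimately show ?thesis
    by (simp add: x_def)
qed

section \<open>Partial derivatives of the iterated scheme\<close>

lemma has_partial_explicit_part:
  assumes "has_partial i (state n) (dstate i n)"
  shows "has_partial i (explicit_part n)
           (\<lambda>x. dstate i n x + \<sigma> / 2 * (of_bool (i = Suc n) - of_bool (i = n)))"
  unfolding explicit_part_def
  by (intro has_partial_add has_partial_cmult has_partial_coordinate_diff assms)

lemma has_partial_state: "has_partial i (state n) (dstate i n)"
proof (induction n)
  case 0
  show ?case using has_partial_const[of i X0] by (simp add: has_partial_def)
next
  case (Suc n)
  from has_partial_compose[OF DERIV_step has_partial_explicit_part[OF this]]
  show ?case by (simp add: has_partial_def explicit_part_def)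
qed

lemma state_local: "(\<And>i. i \<le> n \<Longrightarrow> x i = y i) \<Longrightarrow> state n x = state n y"
  by (induction n) simp_all

lemma continuous_root_term [continuous_intros]:
  "continuous_on A f \<Longrightarrow> continuous_on A (\<lambda>x. root_term (f x))"
  unfolding root_term_def by (intro continuous_intros)

lemma continuous_state: "continuous_on UNIV (state n)"
proof (induction n)
  case (Suc n)
  thus ?case
    using denom_pos
    by (auto simp: step_def intro!: continuous_intros continuous_on_product_coordinates)
qed simp

lemma dstate_in_algebra: "dstate i n \<in> fun_algebra generators"
proof (induction n)
  case 0
  show ?case using fun_algebra.const[of 0] by simp
next
  case (Suc n)
  \<comment> \<open>The division in \<open>slope\<close> becomes a constant factor, and the
    \<open>of_bool\<close> terms are constant in \<open>x\<close>, so the algebra rules apply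
    directly.\<close>
  have "(\<lambda>x. (1 + explicit_part n x / root_term (explicit_part n x)) * inverse (2 + \<kappa> * h) *
      (dstate i n x + \<sigma> / 2 * (of_bool (i = Suc n) - of_bool (i = n)))) \<in> fun_algebra generators"
    by (intro fun_algebra.mult fun_algebra.add fun_algebra.const Suc fun_algebra.gen)
      (auto simp: generators_def)
  also have "(\<lambda>x. (1 + explicit_part n x / root_term (explicit_part n x)) * inverse (2 + \<kappa> * h) *
      (dstate i n x + \<sigma> / 2 * (of_bool (i = Suc n) - of_bool (i = n)))) = dstate i (Suc n)"
    unfolding fun_eq_iff dstate.simps slope_def divide_inverse by (rule allI) (rule refl)
  finally show ?case .
qed

lemma generators_continuous: "g \<in> generators \<Longrightarrow> continuous_on UNIV g"
proof -
  have "continuous_on UNIV (explicit_part n)" for n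
    unfolding explicit_part_def
    by (intro continuous_intros continuous_state continuous_on_product_coordinates)
  moreover have "root_term y \<noteq> 0" for y
    using root_term_pos[of y] by simp
  ultimately show "g \<in> generators \<Longrightarrow> continuous_on UNIV g"
    unfolding generators_def by (elim UnE rangeE) (simp_all add: continuous_intros)
qed

lemma generators_bounded:
  assumes "g \<in> generators"
  shows "bounded (range g)"
proof -
  let ?c = "\<kappa> * h * \<theta> * (2 + \<kappa> * h)"
  have "\<bar>y / root_term y\<bar> \<le> 1" for y
    using abs_less_root_term[of y] by (simp add: abs_divide)
  \<comment> \<open>\<open>root_term\<close> attains its minimum, the positive number
    \<open>sqrt ?c\<close>, at 0.\<close>
  moreover have "\<bar>inverse (root_term y)\<bar> \<le> inverse (sqrt ?c)" for y
    using root_term_pos[of y] disc_pos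
    by (auto simp: root_term_def intro!: le_imp_inverse_le)
  ultimately show ?thesis
    using assms unfolding generators_def
  proof (elim UnE rangeE)
  qed (auto simp only: bounded_iff real_norm_def)
qed

text \<open>The outer derivatives are polynomials in the generators, and the inner ones lie in the
  algebra by \<open>dstate_in_algebra\<close>.\<close>

lemma generators_has_partial:
  assumes "g \<in> generators"
  shows "\<exists>g'\<in>fun_algebra generators. has_partial i g g'"
proof -
  let ?v = "\<lambda>n x. explicit_part n x / root_term (explicit_part n x)"
  let ?w = "\<lambda>n x. inverse (root_term (explicit_part n x))"
  have v: "?v n \<in> fun_algebra generators" and w: "?w n \<in> fun_algebra generators" for n
    by (auto simp: generators_def intro!: fun_algebra.gen)
  consider n where "g = ?v n" | n where "g = ?w n"
    using assms unfolding generators_def by (elim UnE rangeE)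
  thus ?thesis
  proof cases
    case 1
    show ?thesis
      unfolding 1
      by (rule has_partial_bexI[OF has_partial_compose[OF DERIV_normalised
              has_partial_explicit_part[OF has_partial_state]]])
        (intro fun_algebra.mult fun_algebra.add fun_algebra.const v w dstate_in_algebra)
  next
    case 2
    show ?thesis
      unfolding 2
      by (rule has_partial_bexI[OF has_partial_compose[OF DERIV_inverse_root_term
              has_partial_explicit_part[OF has_partial_state]]])
        (intro fun_algebra.mult fun_algebra.add fun_algebra.const v w dstate_in_algebra)
  qed
qed

section \<open>Identification with the scheme and with \<open>G_fun\<close>\<close>

text \<open>Agreement is asked only up to index \<open>n\<close>, which leaves later coordinates
  free to be sampled at capped times.\<close>

lemma scheme_eq_state:
  "(\<And>i. i \<le> n \<Longrightarrow> x i = B (real i * h) \<omega>) \<Longrightarrow> scheme \<kappa> \<theta> \<sigma> X0 h B n \<omega> = state n x"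
  by (induction n) (simp_all add: Let_def step_def root_term_def)

text \<open>Every old product gains the factor with index \<open>Suc n\<close>, and the new grid
  interval contributes that factor alone.\<close>

lemma G_fun_Suc:
  "G_fun \<kappa> \<theta> \<sigma> h X (Suc n) \<omega> s =
     inverse (1 - deriv (drift \<kappa> \<theta>) (X (Suc n) \<omega>) * h) *
       (G_fun \<kappa> \<theta> \<sigma> h X n \<omega> s + \<sigma> / 2 * indicator {real n * h<..real (Suc n) * h} s)"
  by (simp add: G_fun_def sum_distrib_left algebra_simps)

text \<open>Both sides obey the same recursion in \<open>n\<close>: the chain rule factor is the new
  factor of \<open>G_fun\<close> by \<open>slope_eq\<close>, and the two indicators coming from the
  increment differ by that of the new grid interval.\<close>

lemma sum_dstate_indicator:
  assumes "n < m" "\<And>j. j \<le> n \<Longrightarrow> X j \<omega> = state j x"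
  shows "(\<Sum>i<m. dstate i n x * indicator {0..real i * h} s) = G_fun \<kappa> \<theta> \<sigma> h X n \<omega> s"
  using assms
proof (induction n)
  case 0
  show ?case by (simp add: G_fun_def)
next
  case (Suc n)
  let ?L = "slope (explicit_part n x)"
  have L: "?L = inverse (1 - deriv (drift \<kappa> \<theta>) (X (Suc n) \<omega>) * h)"
    using Suc.prems(2)[of "Suc n"] by (simp add: slope_eq explicit_part_def)
  have ind: "(indicator {real n * h<..real (Suc n) * h} s :: real) =
      indicator {0..real (Suc n) * h} s - indicator {0..real n * h} s"
  proof -
    have "0 \<le> real n * h" "real n * h \<le> real (Suc n) * h"
      using h_pos by simp_all
    thus ?thesis by (auto simp: indicator_def simp del: of_nat_Suc)
  qed
  \<comment> \<open>Each conditional sum picks out a single summand; both indices lie below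
    \<open>m\<close> since \<open>Suc n < m\<close>.\<close>
  have "(\<Sum>i<m. dstate i (Suc n) x * indicator {0..real i * h} s) =
      ?L * ((\<Sum>i<m. dstate i n x * indicator {0..real i * h} s) + \<sigma> / 2 *
        ((\<Sum>i<m. if i = Suc n then indicator {0..real i * h} s else 0) -
         (\<Sum>i<m. if i = n then indicator {0..real i * h} s else 0)))"
    unfolding sum_distrib_left sum_subtractf[symmetric] sum.distrib[symmetric]
    by (intro sum.cong) (auto simp: algebra_simps)
  also have "\<dots> = ?L * (G_fun \<kappa> \<theta> \<sigma> h X n \<omega> s +
      \<sigma> / 2 * indicator {real n * h<..real (Suc n) * h} s)"
    using Suc by (simp add: ind del: of_nat_Suc)
  finally show ?case
    by (simp only: G_fun_Suc L)
qed

text \<open>All grid intervals in \<open>G_fun\<close> lie in (0, nh], so the cut-off factors of the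
  final formula are absorbed.\<close>

lemma G_fun_mult_indicator:
  "G_fun \<kappa> \<theta> \<sigma> h X n \<omega> s * indicator {0..real n * h} s = G_fun \<kappa> \<theta> \<sigma> h X n \<omega> s"
proof -
  have "indicator {real (i - 1) * h<..real i * h} s * indicator {0..real n * h} s =
      (indicator {real (i - 1) * h<..real i * h} s :: real)" if "i \<in> {1..n}" for i
  proof -
    have "real i * h \<le> real n * h" "0 \<le> real (i - 1) * h"
      using that h_pos by auto
    thus ?thesis by (auto simp: indicator_def)
  qed
  thus ?thesis
    unfolding G_fun_def sum_distrib_right by (intro sum.cong) (simp_all add: mult.assoc)
qed

end

section \<open>Malliavin derivatives of functions with bounded partial derivatives\<close>

lemma (in prob_space) gaussian_rv_square_integrable:
  assumes "gaussian_rv M Y"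
  shows "integrable M (\<lambda>\<omega>. (Y \<omega>)\<^sup>2)"
proof -
  from assms have [measurable]: "Y \<in> borel_measurable M"
    by (simp add: gaussian_rv_def)
  from assms consider \<mu> where "AE \<omega> in M. Y \<omega> = \<mu>"
    | \<mu> s where "s > 0" "distributed M lborel Y (normal_density \<mu> s)"
    by (auto simp: gaussian_rv_def)
  thus ?thesis
  proof cases
    case 1
    hence "AE \<omega> in M. (Y \<omega>)\<^sup>2 = \<mu>\<^sup>2" by eventually_elim simp
    thus ?thesis by (subst integrable_cong_AE[where g = "\<lambda>_. \<mu>\<^sup>2"]) auto
  next
    case 2
    \<comment> \<open>The split x^2 = (x - \<mu>)^2 + 2 \<mu> (x - \<mu>) + \<mu>^2 reduces the
      claim to central moments.\<close>
    have "integrable lborel (\<lambda>x. normal_density \<mu> s x * (x - \<mu>) ^ 2 +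
        (2 * \<mu> * (normal_density \<mu> s x * (x - \<mu>) ^ 1) + \<mu>\<^sup>2 * normal_density \<mu> s x))"
      using 2 by (intro Bochner_Integration.integrable_add integrable_mult_right
          integrable_normal_moment integrable_normal_density)
    also have "(\<lambda>x. normal_density \<mu> s x * (x - \<mu>) ^ 2 +
        (2 * \<mu> * (normal_density \<mu> s x * (x - \<mu>) ^ 1) + \<mu>\<^sup>2 * normal_density \<mu> s x)) =
        (\<lambda>x. normal_density \<mu> s x * x\<^sup>2)"
      by (auto simp: power2_eq_square algebra_simps)
    finally show ?thesis
      using distributed_integrable[OF 2(2), of "\<lambda>x. x\<^sup>2"] by simp
  qed
qed

lemma integrable_square_add:
  fixes f g :: "'a \<Rightarrow> real"
  assumes [measurable]: "f \<in> borel_measurable M" "g \<in> borel_measurable M"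
    and int: "integrable M (\<lambda>x. (f x)\<^sup>2)" "integrable M (\<lambda>x. (g x)\<^sup>2)"
  shows "integrable M (\<lambda>x. (f x + g x)\<^sup>2)"
proof (rule Bochner_Integration.integrable_bound)
  show "integrable M (\<lambda>x. 2 * (f x)\<^sup>2 + 2 * (g x)\<^sup>2)"
    using int by simp
  have "(a + b)\<^sup>2 \<le> 2 * a\<^sup>2 + 2 * b\<^sup>2" for a b :: real
    using zero_le_power2[of "a - b"] by (simp add: power2_eq_square algebra_simps)
  thus "AE x in M. norm ((f x + g x)\<^sup>2) \<le> norm (2 * (f x)\<^sup>2 + 2 * (g x)\<^sup>2)"
    by simp
qed simp

lemma integrable_square_cmult:
  fixes f :: "'a \<Rightarrow> real"
  shows "integrable M (\<lambda>x. (f x)\<^sup>2) \<Longrightarrow> integrable M (\<lambda>x. (c * f x)\<^sup>2)"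
  by (simp add: power_mult_distrib)

context fractional_brownian_motion
begin

lemma gaussian_rv_B: "t \<in> {0..T} \<Longrightarrow> gaussian_rv M (B t)"
  using gaussian[unfolded gaussian_process_def, rule_format, of 1 "\<lambda>_. t" "\<lambda>_. 1"] by simp

lemma measurable_B: "t \<in> {0..T} \<Longrightarrow> B t \<in> borel_measurable M"
  using gaussian_rv_B by (simp add: gaussian_rv_def)

lemma square_integrable_B: "t \<in> {0..T} \<Longrightarrow> integrable M (\<lambda>\<omega>. (B t \<omega>)\<^sup>2)"
  by (intro gaussian_rv_square_integrable gaussian_rv_B)

end

text \<open>Induction extends the two-term rule \<open>linear\<close>. An embedded step function
  with random coefficients thereby becomes a random combination of fixed vectors.\<close>

lemma (in fbm_hilbert_space) embed_sum:
  fixes s :: "nat \<Rightarrow> real"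
  assumes "\<And>i. i < m \<Longrightarrow> s i \<in> {0..T}"
  shows "\<iota> (\<lambda>r. \<Sum>i<m. c i * indicator {0..s i} r) = (\<Sum>i<m. c i *\<^sub>R \<iota> (indicator {0..s i}))"
  using assms
proof (induction m)
  case 0
  have "(\<lambda>r. 0) \<in> step_functions T"
    unfolding step_functions_def by (auto intro!: exI[of _ 0])
  from linear[OF this this, of 0 0] show ?case by simp
next
  case (Suc m)
  have "(\<lambda>r. \<Sum>i<m. c i * indicator {0..s i} r) \<in> step_functions T"
    unfolding step_functions_def mem_Collect_eq
    by (rule exI[of _ m], rule exI[of _ c], rule exI[of _ s]) (use Suc.prems in auto)
  moreover have "indicator {0..s m} \<in> step_functions T"
    unfolding step_functions_def mem_Collect_eq
    by (rule exI[of _ 1], rule exI[of _ "\<lambda>_. 1"], rule exI[of _ "\<lambda>_. s m"])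
      (use Suc.prems in auto)
  ultimately show ?case
    using linear[of "\<lambda>r. \<Sum>i<m. c i * indicator {0..s i} r" "indicator {0..s m}" 1 "c m"] Suc
    by simp
qed

text \<open>For nonzero \<open>x\<close> the term is \<open>x\<close> times sin u / u with u = x /
  (k + 1), and u tends to 0 through nonzero values.\<close>

lemma scaled_sin_tendsto: "(\<lambda>k. real (Suc k) * sin (x / real (Suc k))) \<longlonglongrightarrow> x"
proof (cases "x = 0")
  case False
  have "(\<lambda>k. x / real (Suc k)) \<longlonglongrightarrow> 0"
    by (intro real_tendsto_divide_at_top[OF tendsto_const]
        filterlim_compose[OF filterlim_real_sequentially filterlim_Suc])
  hence "filterlim (\<lambda>k. x / real (Suc k)) (at 0) sequentially"
    using False by (simp add: filterlim_at)
  from tendsto_mult[OF tendsto_const[of x] filterlim_compose[OF sinc_at_0 this]]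
  show ?thesis using False by (simp add: mult.commute del: of_nat_Suc)
qed simp

text \<open>
  The approximation \<open>K * sin (\<Phi> / K)\<close> makes \<open>\<Phi>\<close> bounded, keeps all derivatives bounded, and its
  derivative is \<open>cos (\<Phi> / K)\<close> times that of \<open>\<Phi>\<close>, so both converge by dominated convergence.
\<close>

lemma has_malliavin_derivative_bounded_partials:
  fixes \<iota> :: "(real \<Rightarrow> real) \<Rightarrow> 'h::{real_inner, polish_space}"
  assumes fbm: "fractional_brownian_motion M T H B"
    and hilbert: "fbm_hilbert_space T H \<iota>"
    and cont: "\<And>g. g \<in> \<G> \<Longrightarrow> continuous_on UNIV g"
    and bdd: "\<And>g. g \<in> \<G> \<Longrightarrow> bounded (range g)"
    and partial: "\<And>g i. g \<in> \<G> \<Longrightarrow> \<exists>g'\<in>fun_algebra \<G>. has_partial i g g'"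
    and \<Phi>_partial: "\<And>i. has_partial i \<Phi> (d\<Phi> i)"
    and d\<Phi>: "\<And>i. d\<Phi> i \<in> fun_algebra \<G>"
    and \<Phi>_cont: "continuous_on UNIV \<Phi>"
    and \<Phi>_local: "\<And>x y. (\<And>i. i < m \<Longrightarrow> x i = y i) \<Longrightarrow> \<Phi> x = \<Phi> y"
    and s: "\<And>i. s i \<in> {0..T}"
    and int: "integrable M (\<lambda>\<omega>. (\<Phi> (\<lambda>j. B (s j) \<omega>))\<^sup>2)"
  shows "has_malliavin_derivative M T \<iota> B 2 (\<lambda>\<omega>. \<Phi> (\<lambda>j. B (s j) \<omega>))
           (\<lambda>\<omega>. \<iota> (\<lambda>r. \<Sum>i<m. d\<Phi> i (\<lambda>j. B (s j) \<omega>) * indicator {0..s i} r))"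
    (is "has_malliavin_derivative M T \<iota> B 2 ?F ?\<eta>")
proof -
  interpret fractional_brownian_motion M T H B by (rule fbm)
  interpret fbm_hilbert_space T H \<iota> by (rule hilbert)
  define b where "b = (\<lambda>\<omega> j. B (s j) \<omega>)"
  define e where "e = (\<lambda>i. \<iota> (indicator {0..s i}))"
  define K where "K = (\<lambda>k. real (Suc k))"
  have K: "K k > 0" for k by (simp add: K_def)
  define \<Psi> where "\<Psi> = (\<lambda>k x. K k * sin (\<Phi> x / K k))"
  define d\<Psi> where "d\<Psi> = (\<lambda>k i x. cos (\<Phi> x / K k) * d\<Phi> i x)"
  \<comment> \<open>The path samples form a random element of sequence space with its product
    topology, so continuous functions of \<open>b\<close> are measurable.\<close>
  have b [measurable]: "b \<in> borel_measurable M"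
    unfolding b_def using s by (intro measurable_coordinatewise_then_product measurable_B)
  have [measurable]: "\<Phi> \<in> borel_measurable borel" "d\<Phi> i \<in> borel_measurable borel" for i
    using \<Phi>_cont fun_algebra_continuous[OF cont d\<Phi>]
    by (auto intro: borel_measurable_continuous_onI)
  have F: "?F \<omega> = \<Phi> (b \<omega>)" for \<omega>
    by (simp add: b_def)
  \<comment> \<open>With the vectors \<open>e i\<close> fixed, measurability and norm bounds reduce
    to the real coefficients.\<close>
  have \<eta>: "?\<eta> \<omega> = (\<Sum>i<m. d\<Phi> i (b \<omega>) *\<^sub>R e i)" for \<omega>
    by (simp only: b_def e_def embed_sum[OF s])
  have F_meas [measurable]: "?F \<in> borel_measurable M"
    unfolding F by measurable
  have \<eta>_meas [measurable]: "?\<eta> \<in> borel_measurable M"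
    unfolding \<eta> by measurable

  have sin_partial: "has_partial i (\<lambda>x. sin (\<Phi> x / K k)) (\<lambda>x. cos (\<Phi> x / K k) * inverse (K k) * d\<Phi> i x)"
    for i k
    using K[of k] by (intro has_partial_compose[OF _ \<Phi>_partial])
      (auto intro!: derivative_eq_intros simp: field_simps)
  have cos_partial: "has_partial i (\<lambda>x. cos (\<Phi> x / K k))
      (\<lambda>x. (- inverse (K k)) * sin (\<Phi> x / K k) * d\<Phi> i x)" for i k
    using K[of k] by (intro has_partial_compose[OF _ \<Phi>_partial])
      (auto intro!: derivative_eq_intros simp: field_simps)
  have \<Psi>_partial: "partial_deriv i (\<Psi> k) = d\<Psi> k i" for i k
  proof -
    \<comment> \<open>The inner derivative cancels the prefactor \<open>K k\<close>, so the
      truncation level survives only inside the cosine.\<close>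
    have "(\<lambda>x. K k * (cos (\<Phi> x / K k) * inverse (K k) * d\<Phi> i x)) = d\<Psi> k i"
      using K[of k] by (auto simp: d\<Psi>_def fun_eq_iff)
    thus ?thesis
      unfolding \<Psi>_def using has_partial_imp_partial_deriv[OF has_partial_cmult[OF sin_partial]]
      by simp
  qed
  have smooth: "bounded_smooth m (\<Psi> k)" for k
  proof (rule bounded_smooth_fun_algebra)
    \<comment> \<open>Sine and cosine of the scaled \<open>\<Phi>\<close> differentiate into each
      other, up to constants and \<open>d\<Phi> i\<close>, so adjoining both preserves closure under
      partial derivatives.\<close>
    let ?\<G> = "\<G> \<union> {\<lambda>x. sin (\<Phi> x / K k), \<lambda>x. cos (\<Phi> x / K k)}"
    have mono: "f \<in> fun_algebra \<G> \<Longrightarrow> f \<in> fun_algebra ?\<G>" for f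
      by (rule fun_algebra_mono[rotated]) auto
    have sc: "(\<lambda>x. sin (\<Phi> x / K k)) \<in> fun_algebra ?\<G>" "(\<lambda>x. cos (\<Phi> x / K k)) \<in> fun_algebra ?\<G>"
      by (auto intro: fun_algebra.gen)
    show "\<Psi> k \<in> fun_algebra ?\<G>"
      unfolding \<Psi>_def by (intro fun_algebra.mult fun_algebra.const sc)
    show "continuous_on UNIV g" if "g \<in> ?\<G>" for g
      using that K[of k] \<Phi>_cont by (auto intro!: continuous_intros intro: cont)
    have "bounded (range (\<lambda>x. sin (\<Phi> x / K k)))" "bounded (range (\<lambda>x. cos (\<Phi> x / K k)))"
      by (auto simp: bounded_iff intro!: exI[of _ 1])
    thus "bounded (range g)" if "g \<in> ?\<G>" for g
      using that bdd by blast
    show "\<exists>g'\<in>fun_algebra ?\<G>. has_partial i g g'" if g: "g \<in> ?\<G>" for g i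
    proof -
      consider "g \<in> \<G>" | "g = (\<lambda>x. sin (\<Phi> x / K k))" | "g = (\<lambda>x. cos (\<Phi> x / K k))"
        using g by blast
      thus ?thesis
      proof cases
        case 1
        thus ?thesis using partial mono by blast
      next
        case 2
        show ?thesis unfolding 2
          by (rule has_partial_bexI[OF sin_partial]) (intro fun_algebra.mult fun_algebra.const sc mono d\<Phi>)
      next
        case 3
        show ?thesis unfolding 3
          by (rule has_partial_bexI[OF cos_partial]) (intro fun_algebra.mult fun_algebra.const sc mono d\<Phi>)
      qed
    qed
    show "\<Psi> k x = \<Psi> k y" if "\<And>i. i < m \<Longrightarrow> x i = y i" for x y
      using \<Phi>_local[OF that] by (simp add: \<Psi>_def)
  qed

  define DF where "DF = (\<lambda>k \<omega>. \<iota> (\<lambda>r. \<Sum>i<m. d\<Psi> k i (b \<omega>) * indicator {0..s i} r))"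
  have DF_eq: "DF k \<omega> = cos (\<Phi> (b \<omega>) / K k) *\<^sub>R ?\<eta> \<omega>" for k \<omega>
    unfolding \<eta> DF_def embed_sum[OF s] by (simp add: e_def d\<Psi>_def scaleR_sum_right)
  have "((\<lambda>\<omega>. \<Psi> k (b \<omega>)), DF k) \<in> smooth_malliavin T \<iota> B" for k
    unfolding smooth_malliavin_def DF_def b_def using smooth s \<Psi>_partial
    by (auto intro!: exI[of _ m] exI[of _ "\<Psi> k"] exI[of _ s])
  moreover have "(\<lambda>k. malliavin_norm_pow M 2 (\<lambda>\<omega>. \<Psi> k (b \<omega>) - ?F \<omega>) (\<lambda>\<omega>. DF k \<omega> - ?\<eta> \<omega>))
      \<longlonglongrightarrow> 0"
  proof -
    have inv0: "(\<lambda>k. x / K k) \<longlonglongrightarrow> 0" for x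
      unfolding K_def by (intro real_tendsto_divide_at_top[OF tendsto_const]
          filterlim_compose[OF filterlim_real_sequentially filterlim_Suc])
    have "(\<lambda>k. \<integral>\<^sup>+\<omega>. ennreal ((\<Psi> k (b \<omega>) - ?F \<omega>)\<^sup>2) \<partial>M) \<longlonglongrightarrow> (\<integral>\<^sup>+\<omega>. 0 \<partial>M)"
    \<comment> \<open>Since |sin u| \<le> |u|, the truncation is at most |\<Phi>| in modulus and the
      error at most 2 |\<Phi>|, which is square integrable by \<open>int\<close>.\<close>
    proof (rule nn_integral_dominated_convergence[where w = "\<lambda>\<omega>. ennreal (4 * (?F \<omega>)\<^sup>2)"])
      show "(\<integral>\<^sup>+\<omega>. ennreal (4 * (?F \<omega>)\<^sup>2) \<partial>M) < \<infinity>"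
        using int by (subst nn_integral_eq_integral) auto
      have "(\<Psi> k x - \<Phi> x)\<^sup>2 \<le> 4 * (\<Phi> x)\<^sup>2" for k x
      proof -
        have "\<bar>\<Psi> k x\<bar> \<le> \<bar>\<Phi> x\<bar>"
          using abs_sin_x_le_abs_x[of "\<Phi> x / K k"] K[of k]
          by (simp add: \<Psi>_def abs_mult abs_divide field_simps)
        hence "\<bar>\<Psi> k x - \<Phi> x\<bar> \<le> \<bar>2 * \<Phi> x\<bar>" by linarith
        thus ?thesis by (simp add: abs_le_square_iff power_mult_distrib)
      qed
      thus "AE \<omega> in M. ennreal ((\<Psi> k (b \<omega>) - ?F \<omega>)\<^sup>2) \<le> ennreal (4 * (?F \<omega>)\<^sup>2)" for k
        unfolding F by (auto intro: ennreal_leI)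
      have "(\<lambda>k. ennreal ((\<Psi> k x - \<Phi> x)\<^sup>2)) \<longlonglongrightarrow> ennreal ((\<Phi> x - \<Phi> x)\<^sup>2)" for x
        using scaled_sin_tendsto[of "\<Phi> x"] unfolding \<Psi>_def K_def
        by (intro tendsto_ennrealI tendsto_intros)
      thus "AE \<omega> in M. (\<lambda>k. ennreal ((\<Psi> k (b \<omega>) - ?F \<omega>)\<^sup>2)) \<longlonglongrightarrow> 0"
        unfolding F by simp
    qed (auto simp: F \<Psi>_def)
    moreover have "(\<lambda>k. \<integral>\<^sup>+\<omega>. ennreal ((norm (DF k \<omega> - ?\<eta> \<omega>))\<^sup>2) \<partial>M) \<longlonglongrightarrow> (\<integral>\<^sup>+\<omega>. 0 \<partial>M)"
    proof -
      \<comment> \<open>Members of the algebra are bounded, so \<open>A\<close> below bounds the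
        derivative uniformly in \<omega>. As |cos x - 1| \<le> 2, the constant \<open>2 * A\<close>
        dominates the error.\<close>
      have "\<exists>C. \<forall>x. \<bar>d\<Phi> i x\<bar> \<le> C" for i
        using fun_algebra_bounded[OF bdd d\<Phi>, of i] by (auto simp: bounded_iff)
      then obtain C where C: "\<And>i x. \<bar>d\<Phi> i x\<bar> \<le> C i" by metis
      define A where "A = (\<Sum>i<m. C i * norm (e i))"
      have \<eta>_bdd: "norm (?\<eta> \<omega>) \<le> A" for \<omega>
        unfolding \<eta> A_def by (intro sum_norm_le) (auto intro!: mult_right_mono C)
      have diff: "norm (DF k \<omega> - ?\<eta> \<omega>) = \<bar>cos (\<Phi> (b \<omega>) / K k) - 1\<bar> * norm (?\<eta> \<omega>)" for k \<omega>
      proof -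
        have "DF k \<omega> - ?\<eta> \<omega> = (cos (\<Phi> (b \<omega>) / K k) - 1) *\<^sub>R ?\<eta> \<omega>"
          by (simp add: DF_eq scaleR_left_diff_distrib)
        thus ?thesis by simp
      qed
      show ?thesis
      proof (rule nn_integral_dominated_convergence[where w = "\<lambda>\<omega>. ennreal ((2 * A)\<^sup>2)"])
        show "(\<integral>\<^sup>+\<omega>. ennreal ((2 * A)\<^sup>2) \<partial>M) < \<infinity>"
          by (simp add: emeasure_space_1)
        have "\<bar>cos x - 1\<bar> \<le> 2" for x :: real
          using cos_le_one[of x] cos_ge_minus_one[of x] by linarith
        hence "norm (DF k \<omega> - ?\<eta> \<omega>) \<le> 2 * A" for k \<omega>
          unfolding diff by (intro mult_mono \<eta>_bdd) simp_all
        thus "AE \<omega> in M. ennreal ((norm (DF k \<omega> - ?\<eta> \<omega>))\<^sup>2) \<le> ennreal ((2 * A)\<^sup>2)" for k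
          by (intro AE_I2 ennreal_leI power_mono) simp_all
        have "(\<lambda>k. ennreal ((norm (DF k \<omega> - ?\<eta> \<omega>))\<^sup>2)) \<longlonglongrightarrow>
            ennreal ((\<bar>cos 0 - 1\<bar> * norm (?\<eta> \<omega>))\<^sup>2)" for \<omega>
          unfolding diff by (intro tendsto_ennrealI tendsto_intros inv0)
        thus "AE \<omega> in M. (\<lambda>k. ennreal ((norm (DF k \<omega> - ?\<eta> \<omega>))\<^sup>2)) \<longlonglongrightarrow> 0"
          by simp
        show "(\<lambda>\<omega>. ennreal ((norm (DF k \<omega> - ?\<eta> \<omega>))\<^sup>2)) \<in> borel_measurable M" for k
          unfolding diff by measurable
      qed simp_all
    qed
    \<comment> \<open>The power \<open>powr 2\<close> in the norm agrees with the square because its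
      bases are nonnegative.\<close>
    ultimately show ?thesis
      unfolding malliavin_norm_pow_def by (auto dest: tendsto_add)
  qed
  ultimately show ?thesis
    unfolding has_malliavin_derivative_def using F_meas \<eta>_meas
    by (intro conjI exI[of _ "\<lambda>k \<omega>. \<Psi> k (b \<omega>)"] exI[of _ DF]) auto
qed

text \<open>By \<open>step_sq_le\<close> the next square is at most that of the explicit part plus a
  constant, which is integrable over a finite measure.\<close>

lemma (in implicit_scheme) state_square_integrable:
  assumes "finite_measure M" "\<And>i. Y i \<in> borel_measurable M" "\<And>i. integrable M (\<lambda>\<omega>. (Y i \<omega>)\<^sup>2)"
  shows "integrable M (\<lambda>\<omega>. (state n (\<lambda>j. Y j \<omega>))\<^sup>2)"
proof -
  interpret finite_measure M by (rule assms)
  note [measurable] = assms(2) borel_measurable_continuous_onI[OF continuous_state]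
  have [measurable]: "(\<lambda>\<omega> j. Y j \<omega>) \<in> borel_measurable M"
    by (intro measurable_coordinatewise_then_product assms)
  show ?thesis
  proof (induction n)
    case 0
    show ?case by simp
  next
    case (Suc n)
    \<comment> \<open>The increment is written as a sum with factor \<open>- 1\<close> to fit
      \<open>integrable_square_add\<close> and \<open>integrable_square_cmult\<close>.\<close>
    let ?e = "\<lambda>\<omega>. state n (\<lambda>j. Y j \<omega>) + \<sigma> / 2 * (Y (Suc n) \<omega> + (- 1) * Y n \<omega>)"
    have "integrable M (\<lambda>\<omega>. (?e \<omega>)\<^sup>2)"
      by (intro integrable_square_add integrable_square_cmult Suc assms(3)) simp_all
    hence "integrable M (\<lambda>\<omega>. (?e \<omega>)\<^sup>2 + \<kappa> * h * \<theta> * (2 + \<kappa> * h))"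
      by simp
    thus ?case
      by (rule Bochner_Integration.integrable_bound)
        (measurable, use disc_pos step_sq_le in \<open>auto intro!: order.trans[OF step_sq_le]\<close>)
  qed
qed

section \<open>The Malliavin derivative of the interpolated scheme\<close>

theorem proposition4p2:
  fixes M :: "'a measure"
    and T H \<kappa> \<theta> \<sigma> X0 \<xi> p h t :: real
    and N n :: nat
    and B :: "real \<Rightarrow> 'a \<Rightarrow> real"
    and \<iota> :: "(real \<Rightarrow> real) \<Rightarrow> 'h::{real_inner, polish_space}"
    and X :: "nat \<Rightarrow> 'a \<Rightarrow> real"
  assumes "T > 0" and "1 / 2 < H" and "H < 1"
    and "\<kappa> * \<theta> > 0" and "\<sigma> > 0" and "X0 > 0"
    and "fractional_brownian_motion M T H B"
    and "fbm_hilbert_space T H \<iota>"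
    and "0 < \<xi>" and "\<xi> < 1" and "p \<ge> 2"
    and "\<forall>s\<in>{0..T}. \<kappa> * \<theta> * exp (\<kappa> * s / 2) \<ge>
           (3 * p + 1) * (LBINT \<tau>:{0..s}. \<sigma>\<^sup>2 / 2 * exp (\<kappa> * \<tau> / 2) *
             (H * (2 * H - 1) * \<bar>s - \<tau>\<bar> powr (2 * H - 2)))"
    and "N \<ge> 1" and "h = T / real N" and "0 < h" and "h < 1"
    and "h * max 0 (- \<kappa> / 2) < 1 - \<xi>"
    and "X = scheme \<kappa> \<theta> \<sigma> X0 h B"
    and "\<kappa> > 0"
    and "n < N" and "t \<in> {real n * h<..real (Suc n) * h}"
  shows "has_malliavin_derivative M T \<iota> B 2 (interpolation h X t)
           (\<lambda>\<omega>. \<iota> (\<lambda>s. (real (Suc n) * h - t) / h * G_fun \<kappa> \<theta> \<sigma> h X n \<omega> s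
                          * indicator {0..real n * h} s
                        + (t - real n * h) / h * G_fun \<kappa> \<theta> \<sigma> h X (Suc n) \<omega> s
                          * indicator {0..real (Suc n) * h} s))"
proof -
  have "\<theta> > 0"
    using assms(4,19) by (simp add: zero_less_mult_iff)
  with assms interpret implicit_scheme \<kappa> \<theta> \<sigma> X0 h
    by unfold_locales auto
  interpret fractional_brownian_motion M T H B by (rule assms)
  \<comment> \<open>The cap at \<open>T\<close> keeps every sample time in the interval, for all
    indices; up to \<open>Suc n\<close>, which is at most \<open>N\<close>, it changes
    nothing.\<close>
  define s where "s = (\<lambda>i. min (real i * h) T)"
  \<comment> \<open>The weight of the right grid value in the interpolation; the left one has weight
    \<open>1 - lam\<close>.\<close>
  define lam where "lam = (t - real n * h) / h"
  define \<Phi> where "\<Phi> = (\<lambda>x. (1 - lam) * state n x + lam * state (Suc n) x)"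
  define d\<Phi> where "d\<Phi> = (\<lambda>i x. (1 - lam) * dstate i n x + lam * dstate i (Suc n) x)"
  have s_T: "s i \<in> {0..T}" for i
    using \<open>h > 0\<close> \<open>T > 0\<close> by (auto simp: s_def)
  have s_eq: "s i = real i * h" if "i \<le> Suc n" for i
  proof -
    have "real i * h \<le> real N * h"
      using that \<open>n < N\<close> \<open>h > 0\<close> by (intro mult_right_mono) auto
    thus ?thesis
      using \<open>h = T / real N\<close> \<open>N \<ge> 1\<close> by (simp add: s_def)
  qed
  have X_eq: "X j \<omega> = state j (\<lambda>i. B (s i) \<omega>)" if "j \<le> Suc n" for j \<omega>
    unfolding \<open>X = _\<close> using that by (intro scheme_eq_state) (simp add: s_eq)
  have F: "interpolation h X t = (\<lambda>\<omega>. \<Phi> (\<lambda>j. B (s j) \<omega>))"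
  proof
    fix \<omega>
    show "interpolation h X t \<omega> = \<Phi> (\<lambda>j. B (s j) \<omega>)"
      unfolding interpolation_eq[OF \<open>0 < h\<close> assms(21)] \<Phi>_def X_eq[OF order.refl] X_eq[OF le_SucI[OF order.refl]]
        lam_def[symmetric] by (simp add: algebra_simps del: state.simps)
  qed
  have weight: "(real (Suc n) * h - t) / h = 1 - lam"
    using \<open>h > 0\<close> by (simp add: lam_def field_simps)
  \<comment> \<open>Equality is shown at every point, 0 included, because \<open>\<iota>\<close> is
    specified on step functions only. The \<open>n + 2\<close> coordinates are those with index 0 to
    \<open>Suc n\<close>.\<close>
  have D: "(\<lambda>r. (real (Suc n) * h - t) / h * G_fun \<kappa> \<theta> \<sigma> h X n \<omega> r * indicator {0..real n * h} r
          + (t - real n * h) / h * G_fun \<kappa> \<theta> \<sigma> h X (Suc n) \<omega> r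
            * indicator {0..real (Suc n) * h} r) =
      (\<lambda>r. \<Sum>i<n + 2. d\<Phi> i (\<lambda>j. B (s j) \<omega>) * indicator {0..s i} r)" for \<omega>
  proof
    fix r
    let ?x = "\<lambda>j. B (s j) \<omega>"
    have G: "(\<Sum>i<n + 2. dstate i k ?x * indicator {0..real i * h} r) = G_fun \<kappa> \<theta> \<sigma> h X k \<omega> r"
      if "k \<le> Suc n" for k
      using that by (intro sum_dstate_indicator X_eq) auto
    have "(\<Sum>i<n + 2. d\<Phi> i ?x * indicator {0..s i} r) =
        (1 - lam) * (\<Sum>i<n + 2. dstate i n ?x * indicator {0..real i * h} r) +
        lam * (\<Sum>i<n + 2. dstate i (Suc n) ?x * indicator {0..real i * h} r)"
      unfolding sum_distrib_left sum.distrib[symmetric]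
      by (intro sum.cong) (auto simp: d\<Phi>_def s_eq algebra_simps simp del: dstate.simps)
    also have "\<dots> = (1 - lam) * G_fun \<kappa> \<theta> \<sigma> h X n \<omega> r + lam * G_fun \<kappa> \<theta> \<sigma> h X (Suc n) \<omega> r"
      by (simp only: G order.refl le_SucI)
    finally show "(real (Suc n) * h - t) / h * G_fun \<kappa> \<theta> \<sigma> h X n \<omega> r * indicator {0..real n * h} r
          + (t - real n * h) / h * G_fun \<kappa> \<theta> \<sigma> h X (Suc n) \<omega> r
            * indicator {0..real (Suc n) * h} r =
        (\<Sum>i<n + 2. d\<Phi> i ?x * indicator {0..s i} r)"
      by (simp only: weight mult.assoc G_fun_mult_indicator flip: lam_def)
  qed
  have state_int: "integrable M (\<lambda>\<omega>. (state k (\<lambda>j. B (s j) \<omega>))\<^sup>2)" for k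
    using s_T by (intro state_square_integrable measurable_B square_integrable_B finite_measure_axioms)
  have state_meas [measurable]: "(\<lambda>\<omega>. state k (\<lambda>j. B (s j) \<omega>)) \<in> borel_measurable M" for k
    using s_T by (intro measurable_compose[OF _ borel_measurable_continuous_onI[OF continuous_state]]
        measurable_coordinatewise_then_product measurable_B)
  show ?thesis
    unfolding F D
  proof (rule has_malliavin_derivative_bounded_partials[OF assms(7,8) generators_continuous
        generators_bounded generators_has_partial])
    show "has_partial i \<Phi> (d\<Phi> i)" for i
      unfolding \<Phi>_def d\<Phi>_def by (intro has_partial_add has_partial_cmult has_partial_state)
    show "d\<Phi> i \<in> fun_algebra generators" for i
      unfolding d\<Phi>_def
      by (intro fun_algebra.add fun_algebra.mult fun_algebra.const dstate_in_algebra)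
    show "continuous_on UNIV \<Phi>"
      unfolding \<Phi>_def by (intro continuous_intros continuous_state)
    show "\<Phi> x = \<Phi> y" if "\<And>i. i < n + 2 \<Longrightarrow> x i = y i" for x y
      using state_local[of n x y] state_local[of "Suc n" x y] that
      by (simp add: \<Phi>_def del: state.simps)
    show "integrable M (\<lambda>\<omega>. (\<Phi> (\<lambda>j. B (s j) \<omega>))\<^sup>2)"
      unfolding \<Phi>_def
      by (intro integrable_square_add integrable_square_cmult state_int) measurable
  qed (use s_T in auto)
qed

end
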